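(* Let $A_i:\mathbb{Z}_{\ge0}\to\mathbb{R}^{n\times n}$, $i=0,\ldots,N$, be bounded and consider the stochastic system $$x(k+1)=A_0(k)x(k)+\sum_{i=1}^N\nu_i(k)A_i(k)x(k),\quad k\ge k_0,\qquad x(k_0)=x_0,\qquad(\ast)$$ where the random signals $\nu_1(k),\ldots,\nu_N(k)$ are stationary, independent of each other and independent of the state $x(k)$. Assume that $\nu_i(k)$ follows a Bernoulli distribution with $\mathbb{P}(\nu_i(k)=1)=p_i$ and $\mathbb{P}(\nu_i(k)=0)=1-p_i$, $i=1,\ldots,N$. The following statements are equivalent: (a) The system $(\ast)$ is uniformly exponentially mean-square stable. (b) There exist functions $P,Q:\mathbb{Z}_{\ge0}\to\mathbb{S}^n_{\succ0}$ and constants $\alpha_1,\alpha_2,\beta_1,\beta_2>0$ such that $\alpha_1I\preceq P(k)\preceq\alpha_2I$, $\beta_1I\preceq Q(k)\preceq\beta_2I$ and $$\sum_{i=0}^N\bar A_i(k)^TP(k+1)\bar A_i(k)-P(k)+Q(k)=0$$ hold for all $k\ge0$, where $$\bar A_0(k)=A_0(k)+\sum_{i=1}^Np_iA_i(k),\qquad\bar A_i(k)=(p_i(1-p_i))^{1/2}A_i(k),\ i=1,\ldots,N.$$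
   Context: $\mathbb{S}^n_{\succ0}$ denotes the real symmetric positive definite $n\times n$ matrices; $\preceq$ is the Loewner order. Independence means that, for each $k$, the random variables $\nu_1(k),\ldots,\nu_N(k)$ and the random vector $x(k)$ are mutually independent. The system is uniformly exponentially mean-square stable if there exist $\rho\in[0,1)$ and $\beta>1$ such that $\mathbb{E}[\|x(k)\|_2^2]\le\beta\rho^{k-k_0}\mathbb{E}[\|x_0\|_2^2]$ for all $k\ge k_0$, all $k_0\ge0$ and all $x_0\in\mathbb{R}^n$. *)

theory Defs
  imports "HOL-Probability.Probability"
begin

definition sym_posdef :: "(real^'n^'n) set" where
  "sym_posdef = {X. transpose X = X \<and> (\<forall>v. v \<noteq> 0 \<longrightarrow> 0 < v \<bullet> (X *v v))}"

definition sym_possemidef :: "(real^'n^'n) set" where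
  "sym_possemidef = {X. transpose X = X \<and> (\<forall>v. 0 \<le> v \<bullet> (X *v v))}"

definition loewner_le :: "real^'n^'n \<Rightarrow> real^'n^'n \<Rightarrow> bool" (infix "\<preceq>\<^sub>L" 50) where
  "X \<preceq>\<^sub>L Y \<longleftrightarrow> Y - X \<in> sym_possemidef"

text \<open>Strict-sense stationarity of a discrete-time real process: the joint law of the whole
  process (equivalently, every finite-dimensional law) is invariant under time shifts.\<close>

definition stationary_process :: "'a measure \<Rightarrow> (nat \<Rightarrow> 'a \<Rightarrow> real) \<Rightarrow> bool" where
  "stationary_process M X \<longleftrightarrow>
     (\<forall>k. X k \<in> borel_measurable M) \<and>
     (\<forall>h. distr M (\<Pi>\<^sub>M k\<in>(UNIV::nat set). borel) (\<lambda>\<omega> k. X (k + h) \<omega>) =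
          distr M (\<Pi>\<^sub>M k\<in>(UNIV::nat set). borel) (\<lambda>\<omega> k. X k \<omega>))"

text \<open>Mutual independence of the real random variables \<open>X 1, \<dots>, X N\<close> and the random vector \<open>x\<close>.
  The constant \<^const>\<open>prob_space.indep_vars\<close> needs all variables to take values in one type, so its
  characterization by independent families of preimages is written out, with the
  index \<open>0\<close> standing for \<open>x\<close>.\<close>

definition indep_signals_state ::
    "'a measure \<Rightarrow> nat \<Rightarrow> (nat \<Rightarrow> 'a \<Rightarrow> real) \<Rightarrow> ('a \<Rightarrow> real^'n) \<Rightarrow> bool" where
  "indep_signals_state M N X x \<longleftrightarrow>
     (\<forall>i\<in>{1..N}. X i \<in> borel_measurable M) \<and> x \<in> borel_measurable M \<and>
     prob_space.indep_sets M
       (\<lambda>i. if i = 0 then {x -` B \<inter> space M | B. B \<in> sets borel}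
            else {X i -` B \<inter> space M | B. B \<in> sets borel})
       {0..N}"

text \<open>\<open>state A \<nu> N k0 x0 k \<omega>\<close> is the solution at time \<open>k\<close>, along the sample \<open>\<omega>\<close>, of
  \<open>x(k+1) = A\<^sub>0(k) x(k) + (\<Sum>i=1..N. \<nu>\<^sub>i(k) A\<^sub>i(k) x(k))\<close> for \<open>k \<ge> k0\<close>, \<open>x(k0) = x0\<close>.
  Here \<open>A i k\<close> is the matrix \<open>A\<^sub>i(k)\<close> and \<open>\<nu> i k\<close> the random variable \<open>\<nu>\<^sub>i(k)\<close>.
  For \<open>k < k0\<close> the value is the irrelevant default \<open>x0\<close>.\<close>

primrec state ::
    "(nat \<Rightarrow> nat \<Rightarrow> real^'n^'n) \<Rightarrow> (nat \<Rightarrow> nat \<Rightarrow> 'a \<Rightarrow> real) \<Rightarrow> nat \<Rightarrow> nat \<Rightarrow> real^'n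
      \<Rightarrow> nat \<Rightarrow> 'a \<Rightarrow> real^'n" where
  "state A \<nu> N k0 x0 0 \<omega> = x0"
| "state A \<nu> N k0 x0 (Suc k) \<omega> =
     (if k0 \<le> k
      then A 0 k *v state A \<nu> N k0 x0 k \<omega>
           + (\<Sum>i=1..N. \<nu> i k \<omega> *\<^sub>R (A i k *v state A \<nu> N k0 x0 k \<omega>))
      else x0)"

lemma state_initial: "state A \<nu> N k0 x0 k0 \<omega> = x0"
  by (cases k0) auto

lemma state_step:
  assumes "k0 \<le> k"
  shows "state A \<nu> N k0 x0 (k + 1) \<omega> =
    A 0 k *v state A \<nu> N k0 x0 k \<omega>
      + (\<Sum>i=1..N. \<nu> i k \<omega> *\<^sub>R (A i k *v state A \<nu> N k0 x0 k \<omega>))"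
  using assms by simp

definition unif_exp_ms_stable ::
    "'a measure \<Rightarrow> (nat \<Rightarrow> nat \<Rightarrow> real^'n^'n) \<Rightarrow> (nat \<Rightarrow> nat \<Rightarrow> 'a \<Rightarrow> real) \<Rightarrow> nat \<Rightarrow> bool" where
  "unif_exp_ms_stable M A \<nu> N \<longleftrightarrow>
     (\<exists>\<rho> \<beta>. 0 \<le> \<rho> \<and> \<rho> < 1 \<and> 1 < \<beta> \<and>
        (\<forall>k0 k x0. k0 \<le> k \<longrightarrow>
           prob_space.expectation M (\<lambda>\<omega>. (norm (state A \<nu> N k0 x0 k \<omega>))\<^sup>2)
             \<le> \<beta> * \<rho> ^ (k - k0) * prob_space.expectation M (\<lambda>\<omega>. (norm x0)\<^sup>2)))"

definition Abar ::
    "(nat \<Rightarrow> nat \<Rightarrow> real^'n^'n) \<Rightarrow> (nat \<Rightarrow> real) \<Rightarrow> nat \<Rightarrow> nat \<Rightarrow> nat \<Rightarrow> real^'n^'n" where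
  "Abar A p N i k =
     (if i = 0 then A 0 k + (\<Sum>j=1..N. p j *\<^sub>R A j k)
      else sqrt (p i * (1 - p i)) *\<^sub>R A i k)"

end

(* The state x(k) satisfies the second-moment identity
     E[x(k+1) . S x(k+1)] = E[x(k) . L_k(S) x(k)],  L_k(S) = sum_i Abar_i(k)^T S Abar_i(k).
   If P, Q solve L_k(P(k+1)) - P(k) + Q(k) = 0 with uniform bounds, E[x . P x] contracts by a
   fixed factor at each step. Conversely, the iterates T_j(k) = L_k(L_{k+1}(... L_{k+j-1}(I)))
   satisfy x0 . T_j(k) x0 = E|x(k+j)|^2 for the solution started from x0 at time k, so stability
   makes P(k) = sum_j T_j(k) converge, and P solves the equation with Q = I. *)

theory Submission
  imports Defs
begin

section \<open>Sums of congruences and their quadratic forms\<close>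

lemma sum_matrix_vector_mult:
  fixes B :: "'i \<Rightarrow> real^'n^'m"
  shows "(\<Sum>i\<in>I. B i) *v v = (\<Sum>i\<in>I. B i *v v)"
  by (induction I rule: infinite_finite_induct) (simp_all add: matrix_vector_mult_add_rdistrib)

lemma inner_congruence:
  fixes B C S :: "real^'n^'n"
  shows "v \<bullet> ((transpose B ** S ** C) *v w) = (B *v v) \<bullet> (S *v (C *v w))"
  by (metis dot_lmul_matrix inner_commute matrix_vector_mul_assoc transpose_matrix_vector)

text \<open>With \<open>B\<close> the matrices \<open>Abar\<close> at time \<open>k\<close>, this is
  the Lyapunov operator of that time: the adjoint, for the trace inner product, of the propagation X
  -> sum of \<open>B i\<close> X \<open>B i\<close>^T of second moments.\<close>

definition congruence_sum :: "nat \<Rightarrow> (nat \<Rightarrow> real^'n^'n) \<Rightarrow> real^'n^'n \<Rightarrow> real^'n^'n" where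
  "congruence_sum N B S = (\<Sum>i=0..N. transpose (B i) ** S ** B i)"

lemma inner_congruence_sum:
  "v \<bullet> (congruence_sum N B S *v w) = (\<Sum>i=0..N. (B i *v v) \<bullet> (S *v (B i *v w)))"
  by (simp add: congruence_sum_def sum_matrix_vector_mult inner_sum_right inner_congruence)

lemma transpose_sum: "transpose (\<Sum>i\<in>I. B i) = (\<Sum>i\<in>I. transpose (B i))"
  by (induction I rule: infinite_finite_induct) (simp_all add: transpose_def vec_eq_iff)

lemma transpose_congruence_sum:
  assumes "transpose S = S"
  shows "transpose (congruence_sum N B S) = congruence_sum N B S"
  using assms by (simp add: congruence_sum_def transpose_sum matrix_transpose_mul matrix_mul_assoc)

lemma matrix_matrix_mult_add_left:
  fixes A B :: "'a::semiring_1^'n^'m"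
  shows "(A + B) ** C = A ** C + B ** C"
  by (vector matrix_matrix_mult_def sum.distrib distrib_right)

text \<open>In finite dimension linearity already gives continuity. This is what allows the operator
  to be applied term by term to the series defining the Lyapunov solution.\<close>

lemma bounded_linear_congruence_sum: "bounded_linear (congruence_sum N B)"
proof -
  have "linear (congruence_sum N B)"
    unfolding congruence_sum_def
    by (intro linear_compose_sum ballI linearI)
      (simp_all add: matrix_add_ldistrib matrix_matrix_mult_add_left matrix_scalar_ac
        flip: scalar_matrix_assoc)
  then show ?thesis
    by (simp add: linear_conv_bounded_linear)
qed

lemma borel_measurable_quadratic_form [measurable]:
  fixes S :: "real^'n^'n"
  shows "(\<lambda>v. v \<bullet> (S *v v)) \<in> borel_measurable borel"
  by (intro borel_measurable_continuous_onI continuous_intros)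

text \<open>Sorts the form by degree in the weights \<open>w\<close>. For centred independent
  weights the linear part and the off-diagonal quadratic part then average to zero. \<open>S\<close>
  is an arbitrary matrix, so both orders of the cross term are kept.\<close>

lemma quadratic_form_add_sum:
  fixes S :: "real^'n^'n"
  shows "(a + (\<Sum>i\<in>I. w i *\<^sub>R b i)) \<bullet> (S *v (a + (\<Sum>i\<in>I. w i *\<^sub>R b i))) =
    a \<bullet> (S *v a) + (\<Sum>i\<in>I. w i * (a \<bullet> (S *v b i) + b i \<bullet> (S *v a)))
      + (\<Sum>i\<in>I. \<Sum>j\<in>I. w i * w j * (b i \<bullet> (S *v b j)))"
proof -
  have "S *v (\<Sum>i\<in>I. w i *\<^sub>R b i) = (\<Sum>i\<in>I. w i *\<^sub>R (S *v b i))"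
    by (simp add: linear_sum[OF matrix_vector_mul_linear] matrix_vector_mult_scaleR)
  moreover have "(\<Sum>i\<in>I. \<Sum>j\<in>I. w i * (w j * (b j \<bullet> (S *v b i)))) =
      (\<Sum>i\<in>I. \<Sum>j\<in>I. w i * (w j * (b i \<bullet> (S *v b j))))"
    by (subst sum.swap) (simp add: mult.left_commute)
  ultimately show ?thesis
    by (simp add: matrix_vector_right_distrib inner_add_left inner_add_right inner_sum_left
        inner_sum_right sum.distrib distrib_left sum_distrib_left mult.assoc)
qed

section \<open>Moments of Bernoulli signals independent of the state\<close>

lemma (in prob_space) bernoulli_AE:
  assumes [measurable]: "X \<in> borel_measurable M"
    and p1: "prob {\<omega> \<in> space M. X \<omega> = (1::real)} = p"
    and p0: "prob {\<omega> \<in> space M. X \<omega> = 0} = 1 - p"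
  shows "AE \<omega> in M. X \<omega> = 0 \<or> X \<omega> = 1"
proof -
  have "prob ({\<omega> \<in> space M. X \<omega> = 1} \<union> {\<omega> \<in> space M. X \<omega> = 0}) = p + (1 - p)"
    unfolding p1[symmetric] p0[symmetric]
    by (subst finite_measure_Union) (auto simp: p1 p0)
  also have "{\<omega> \<in> space M. X \<omega> = 1} \<union> {\<omega> \<in> space M. X \<omega> = 0} =
      {\<omega> \<in> space M. X \<omega> = 0 \<or> X \<omega> = 1}"
    by auto
  finally show ?thesis
    by (simp add: prob_Collect_eq_1)
qed

text \<open>Almost surely \<open>g (X \<omega>)\<close> is an affine function of the indicator of
  the event \<open>X \<omega> = 1\<close>, which settles both integrability and the mean.\<close>

lemma (in prob_space) bernoulli_expectation:
  fixes g :: "real \<Rightarrow> real"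
  assumes [measurable]: "X \<in> borel_measurable M" "g \<in> borel_measurable borel"
    and p1: "prob {\<omega> \<in> space M. X \<omega> = 1} = p"
    and p0: "prob {\<omega> \<in> space M. X \<omega> = 0} = 1 - p"
  shows "integrable M (\<lambda>\<omega>. g (X \<omega>))"
    and "expectation (\<lambda>\<omega>. g (X \<omega>)) = p * g 1 + (1 - p) * g 0"
proof -
  let ?I = "indicator {\<omega> \<in> space M. X \<omega> = 1} :: 'a \<Rightarrow> real"
  have ae: "AE \<omega> in M. g (X \<omega>) = g 0 + (g 1 - g 0) * ?I \<omega>"
    using bernoulli_AE[OF assms(1) p1 p0] AE_space by eventually_elim auto
  have int: "integrable M ?I"
    by (simp add: integrable_indicator_iff less_top[symmetric] emeasure_eq_measure)
  then have int': "integrable M (\<lambda>\<omega>. g 0 + (g 1 - g 0) * ?I \<omega>)"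
    by simp
  show "integrable M (\<lambda>\<omega>. g (X \<omega>))"
    by (rule integrable_cong_AE_imp[OF int']) (use ae in \<open>auto elim: eventually_mono\<close>)
  have "expectation (\<lambda>\<omega>. g (X \<omega>)) = expectation (\<lambda>\<omega>. g 0 + (g 1 - g 0) * ?I \<omega>)"
    by (rule integral_cong_AE) (use ae in auto)
  also have "\<dots> = g 0 + (g 1 - g 0) * p"
    using int p1 by (simp add: prob_space)
  finally show "expectation (\<lambda>\<omega>. g (X \<omega>)) = p * g 1 + (1 - p) * g 0"
    by (simp add: algebra_simps)
qed

text \<open>Composition with \<open>g i\<close> and \<open>f\<close> makes the scalar signals and
  the vector state real-valued, so that they form one family \<open>Y\<close> over
  \<open>insert 0 J\<close>. Its generating families of preimages only shrink, so independence
  survives and expectations of products factor.\<close>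

lemma (in prob_space) indep_signals_state_product:
  fixes x :: "'a \<Rightarrow> real^'n" and f :: "real^'n \<Rightarrow> real"
  assumes ind: "indep_signals_state M N X x" and J: "J \<subseteq> {1..N}"
    and g: "\<And>i. i \<in> J \<Longrightarrow> g i \<in> borel_measurable borel"
    and f [measurable]: "f \<in> borel_measurable borel"
    and gi: "\<And>i. i \<in> J \<Longrightarrow> integrable M (\<lambda>\<omega>. g i (X i \<omega>) :: real)"
    and fi: "integrable M (\<lambda>\<omega>. f (x \<omega>))"
  shows "integrable M (\<lambda>\<omega>. (\<Prod>i\<in>J. g i (X i \<omega>)) * f (x \<omega>))"
    and "expectation (\<lambda>\<omega>. (\<Prod>i\<in>J. g i (X i \<omega>)) * f (x \<omega>)) =
      (\<Prod>i\<in>J. expectation (\<lambda>\<omega>. g i (X i \<omega>))) * expectation (\<lambda>\<omega>. f (x \<omega>))"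
proof -
  define Y where "Y i = (if i = 0 then (\<lambda>\<omega>. f (x \<omega>)) else (\<lambda>\<omega>. g i (X i \<omega>)))" for i
  have fin: "finite J" and J0: "0 \<notin> J"
    using J finite_subset by auto
  have [measurable]: "x \<in> borel_measurable M" and X [measurable]: "\<And>i. i \<in> J \<Longrightarrow> X i \<in> borel_measurable M"
    using ind J by (auto simp: indep_signals_state_def)
  have sub: "{Y i -` B \<inter> space M | B. B \<in> sets borel} \<subseteq>
      (if i = 0 then {x -` B \<inter> space M | B. B \<in> sets borel}
       else {X i -` B \<inter> space M | B. B \<in> sets borel})"
    if i: "i \<in> insert 0 J" for i
  proof
    fix E assume "E \<in> {Y i -` B \<inter> space M | B. B \<in> sets borel}"
    then obtain B where B: "B \<in> sets borel" "E = Y i -` B \<inter> space M"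
      by auto
    show "E \<in> (if i = 0 then {x -` B \<inter> space M | B. B \<in> sets borel}
       else {X i -` B \<inter> space M | B. B \<in> sets borel})"
    proof (cases "i = 0")
      case True
      have "f -` B \<in> sets borel"
        using measurable_sets[OF f B(1)] by simp
      moreover have "E = x -` (f -` B) \<inter> space M"
        using B(2) True by (auto simp: Y_def)
      ultimately show ?thesis
        using True by auto
    next
      case False
      then have "g i -` B \<in> sets borel"
        using i measurable_sets[OF g B(1)] by simp
      moreover have "E = X i -` (g i -` B) \<inter> space M"
        using B(2) False by (auto simp: Y_def)
      ultimately show ?thesis
        using False by auto
    qed
  qed
  have "indep_sets (\<lambda>i. {Y i -` B \<inter> space M | B. B \<in> sets borel}) (insert 0 J)"
    using ind J unfolding indep_signals_state_def
    by (intro indep_sets_mono[OF _ _ sub]) auto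
  moreover have "random_variable borel (Y i)" if "i \<in> insert 0 J" for i
    using that J0 g X by (auto simp: Y_def intro: measurable_compose)
  ultimately have indY: "indep_vars (\<lambda>_. borel) Y (insert 0 J)"
    by (simp add: indep_vars_def2)
  have intY: "integrable M (Y i)" if "i \<in> insert 0 J" for i
    using that J0 gi fi by (auto simp: Y_def)
  \<comment> \<open>\<open>h\<close> stays abstract because it is used in two ways: as evaluation at
    a sample point, for the product of the variables, and as expectation, for the product of the
    means.\<close>
  have prodY: "(\<Prod>i\<in>insert 0 J. h (Y i)) = (\<Prod>i\<in>J. h (\<lambda>\<omega>. g i (X i \<omega>))) * h (\<lambda>\<omega>. f (x \<omega>))"
    for h :: "('a \<Rightarrow> real) \<Rightarrow> real"
  proof -
    have "(\<Prod>i\<in>J. h (Y i)) = (\<Prod>i\<in>J. h (\<lambda>\<omega>. g i (X i \<omega>)))"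
      using J0 by (intro prod.cong) (auto simp: Y_def)
    then show ?thesis
      using fin J0 by (simp add: Y_def mult.commute)
  qed
  show "integrable M (\<lambda>\<omega>. (\<Prod>i\<in>J. g i (X i \<omega>)) * f (x \<omega>))"
    using indep_vars_integrable[OF _ indY intY] fin by (simp add: prodY[of "\<lambda>y. y _"])
  show "expectation (\<lambda>\<omega>. (\<Prod>i\<in>J. g i (X i \<omega>)) * f (x \<omega>)) =
      (\<Prod>i\<in>J. expectation (\<lambda>\<omega>. g i (X i \<omega>))) * expectation (\<lambda>\<omega>. f (x \<omega>))"
    using indep_vars_lebesgue_integral[OF _ indY intY] fin
    by (simp add: prodY[of "\<lambda>y. y _"] prodY)
qed

section \<open>Propagation of quadratic forms over one time step\<close>

lemma (in prob_space) integrable_quadratic_form: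
  fixes x :: "'a \<Rightarrow> real^'n" and C :: "real^'n^'n"
  assumes [measurable]: "x \<in> borel_measurable M" and bd: "AE \<omega> in M. norm (x \<omega>) \<le> c"
  shows "integrable M (\<lambda>\<omega>. x \<omega> \<bullet> (C *v x \<omega>))"
proof -
  have meas: "(\<lambda>\<omega>. x \<omega> \<bullet> (C *v x \<omega>)) \<in> borel_measurable M"
    by (rule measurable_compose[OF assms(1) borel_measurable_quadratic_form])
  obtain K where K: "\<And>v. norm (C *v v) \<le> norm v * K" "0 < K"
    using bounded_linear.pos_bounded[OF matrix_vector_mul_bounded_linear[of C]] by auto
  have "AE \<omega> in M. norm (x \<omega> \<bullet> (C *v x \<omega>)) \<le> c * (c * K)"
    using bd
  proof eventually_elim
    case (elim \<omega>)
    have "norm (x \<omega> \<bullet> (C *v x \<omega>)) \<le> norm (x \<omega>) * norm (C *v x \<omega>)"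
      by (simp add: Cauchy_Schwarz_ineq2)
    also have "\<dots> \<le> c * (c * K)"
      using elim K by (intro mult_mono order_trans[OF K(1)]) (auto intro: order_trans[OF norm_ge_zero])
    finally show ?case .
  qed
  then show ?thesis
    by (rule integrable_const_bound) (fact meas)
qed

text \<open>Independence factors the expectations and each \<open>X i \<omega> - p i\<close> has
  mean zero, so only the diagonal case survives, with the Bernoulli variance
  \<open>p i * (1 - p i)\<close>. In the application \<open>f\<close> is a quadratic form.\<close>

lemma (in prob_space) centred_weights:
  fixes x :: "'a \<Rightarrow> real^'n" and f :: "real^'n \<Rightarrow> real"
  assumes ind: "indep_signals_state M N X x"
    and b1: "\<And>i. i \<in> {1..N} \<Longrightarrow> prob {\<omega> \<in> space M. X i \<omega> = 1} = p i"
    and b0: "\<And>i. i \<in> {1..N} \<Longrightarrow> prob {\<omega> \<in> space M. X i \<omega> = 0} = 1 - p i"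
    and f: "f \<in> borel_measurable borel" and fi: "integrable M (\<lambda>\<omega>. f (x \<omega>))"
    and i: "i \<in> {1..N}"
  shows "has_bochner_integral M (\<lambda>\<omega>. (X i \<omega> - p i) * f (x \<omega>)) 0"
    and "j \<in> {1..N} \<Longrightarrow> has_bochner_integral M (\<lambda>\<omega>. (X i \<omega> - p i) * (X j \<omega> - p j) * f (x \<omega>))
      (if i = j then p i * (1 - p i) * expectation (\<lambda>\<omega>. f (x \<omega>)) else 0)"
proof -
  have X: "X i \<in> borel_measurable M" if "i \<in> {1..N}" for i
    using ind that by (simp add: indep_signals_state_def)
  have int1: "integrable M (\<lambda>\<omega>. X i \<omega> - p i)" "expectation (\<lambda>\<omega>. X i \<omega> - p i) = 0"
    if i: "i \<in> {1..N}" for i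
    using bernoulli_expectation[OF X[OF i] _ b1[OF i] b0[OF i], of "\<lambda>t. t - p i"]
    by (simp_all add: algebra_simps)
  have int2: "integrable M (\<lambda>\<omega>. (X i \<omega> - p i) * (X i \<omega> - p i))"
    "expectation (\<lambda>\<omega>. (X i \<omega> - p i) * (X i \<omega> - p i)) = p i * (1 - p i)"
    if i: "i \<in> {1..N}" for i
    using bernoulli_expectation[OF X[OF i] _ b1[OF i] b0[OF i], of "\<lambda>t. (t - p i) * (t - p i)"]
    by (simp_all add: algebra_simps)
  show "has_bochner_integral M (\<lambda>\<omega>. (X i \<omega> - p i) * f (x \<omega>)) 0"
    using indep_signals_state_product[OF ind _ _ f _ fi, of "{i}" "\<lambda>i t. t - p i"] i int1
    by (simp add: has_bochner_integral_iff)
  show "has_bochner_integral M (\<lambda>\<omega>. (X i \<omega> - p i) * (X j \<omega> - p j) * f (x \<omega>))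
      (if i = j then p i * (1 - p i) * expectation (\<lambda>\<omega>. f (x \<omega>)) else 0)"
    if j: "j \<in> {1..N}"
  proof (cases "i = j")
    case True
    then show ?thesis
      \<comment> \<open>On the diagonal the two weights are the same variable, so the square enters
        the product rule as a single factor.\<close>
      using indep_signals_state_product[OF ind _ _ f _ fi, of "{i}" "\<lambda>i t. (t - p i) * (t - p i)"]
        i int2 by (simp add: has_bochner_integral_iff)
  next
    case False
    have "integrable M (\<lambda>\<omega>. X l \<omega> - p l)" if "l \<in> {i, j}" for l
      using that i j int1 by auto
    from indep_signals_state_product[OF ind _ _ f this fi, of "{i, j}"] False show ?thesis
      using i j int1
      by (simp add: has_bochner_integral_iff)
  qed
qed

text \<open>Centring the signals makes all mixed moments vanish; the diagonal ones are the
  Bernoulli variances, whence the square roots in \<^const>\<open>Abar\<close>.\<close>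

lemma (in prob_space) expectation_quadratic_form_step:
  fixes x :: "'a \<Rightarrow> real^'n" and A :: "nat \<Rightarrow> nat \<Rightarrow> real^'n^'n" and k :: nat
  assumes ind: "indep_signals_state M N X x"
    and b1: "\<And>i. i \<in> {1..N} \<Longrightarrow> prob {\<omega> \<in> space M. X i \<omega> = 1} = p i"
    and b0: "\<And>i. i \<in> {1..N} \<Longrightarrow> prob {\<omega> \<in> space M. X i \<omega> = 0} = 1 - p i"
    and bd: "AE \<omega> in M. norm (x \<omega>) \<le> c"
  defines "y \<equiv> \<lambda>\<omega>. A 0 k *v x \<omega> + (\<Sum>i=1..N. X i \<omega> *\<^sub>R (A i k *v x \<omega>))"
  shows "expectation (\<lambda>\<omega>. y \<omega> \<bullet> (S *v y \<omega>)) =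
    expectation (\<lambda>\<omega>. x \<omega> \<bullet> (congruence_sum N (\<lambda>i. Abar A p N i k) S *v x \<omega>))"
proof -
  define w where "w i \<omega> = X i \<omega> - p i" for i \<omega>
  define B where "B = Abar A p N 0 k"
  define q where "q C v = v \<bullet> (C *v v)" for C :: "real^'n^'n" and v
  \<comment> \<open>\<open>C1\<close> and \<open>C2\<close> express the cross terms as quadratic
    forms in the state alone, the shape f(x) that \<open>centred_weights\<close> expects.\<close>
  define C1 where "C1 i = transpose B ** S ** A i k + transpose (A i k) ** S ** B" for i
  define C2 where "C2 i j = transpose (A i k) ** S ** A j k" for i j
  have x: "x \<in> borel_measurable M"
    using ind by (simp add: indep_signals_state_def)
  have qm: "q C \<in> borel_measurable borel" for C
    using borel_measurable_quadratic_form[of C] by (simp add: q_def[abs_def])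
  have qi: "integrable M (\<lambda>\<omega>. q C (x \<omega>))" for C
    using integrable_quadratic_form[OF x bd] by (simp add: q_def)
  \<comment> \<open>Moving the mean of each signal into the drift turns \<open>A 0 k\<close> into
    \<open>Abar A p N 0 k\<close> and leaves the centred weights \<open>w\<close>.\<close>
  have y: "y \<omega> = B *v x \<omega> + (\<Sum>i=1..N. w i \<omega> *\<^sub>R (A i k *v x \<omega>))" for \<omega>
    by (simp add: y_def B_def w_def Abar_def matrix_vector_mult_add_rdistrib
        sum_matrix_vector_mult scaleR_diff_left sum_subtractf flip: scaleR_matrix_vector_assoc)
  have expand: "y \<omega> \<bullet> (S *v y \<omega>) = q (transpose B ** S ** B) (x \<omega>)
      + (\<Sum>i=1..N. w i \<omega> * q (C1 i) (x \<omega>))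
      + (\<Sum>i=1..N. \<Sum>j=1..N. w i \<omega> * w j \<omega> * q (C2 i j) (x \<omega>))" for \<omega>
    unfolding y quadratic_form_add_sum
    by (simp add: q_def C1_def C2_def inner_congruence matrix_vector_mult_add_rdistrib inner_add_right)
  have "has_bochner_integral M (\<lambda>\<omega>. y \<omega> \<bullet> (S *v y \<omega>))
      (expectation (\<lambda>\<omega>. q (transpose B ** S ** B) (x \<omega>)) + (\<Sum>i=1..N. 0)
       + (\<Sum>i=1..N. \<Sum>j=1..N.
           if i = j then p i * (1 - p i) * expectation (\<lambda>\<omega>. q (C2 i j) (x \<omega>)) else 0))"
    unfolding expand w_def
    by (intro has_bochner_integral_add has_bochner_integral_sum centred_weights[OF ind b1 b0 qm qi]
        has_bochner_integral_integrable qi) auto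
  then have "expectation (\<lambda>\<omega>. y \<omega> \<bullet> (S *v y \<omega>)) =
      expectation (\<lambda>\<omega>. q (transpose B ** S ** B) (x \<omega>))
       + (\<Sum>i=1..N. p i * (1 - p i) * expectation (\<lambda>\<omega>. q (C2 i i) (x \<omega>)))"
    by (simp add: has_bochner_integral_iff sum.delta)
  also have "\<dots> = expectation (\<lambda>\<omega>. q (transpose B ** S ** B) (x \<omega>)
       + (\<Sum>i=1..N. p i * (1 - p i) * q (C2 i i) (x \<omega>)))"
    using qi by (simp add: Bochner_Integration.integral_sum)
  also have "\<dots> = expectation (\<lambda>\<omega>. x \<omega> \<bullet> (congruence_sum N (\<lambda>i. Abar A p N i k) S *v x \<omega>))"
  proof (rule Bochner_Integration.integral_cong[OF refl])
    fix \<omega>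
    \<comment> \<open>Both factors are probabilities, hence nonnegative, so squaring the square root
      in \<open>Abar\<close> really returns \<open>p i * (1 - p i)\<close>.\<close>
    have pp: "0 \<le> p i * (1 - p i)" if "i \<in> {1..N}" for i
      using b1[OF that] b0[OF that] by (metis measure_nonneg mult_nonneg_nonneg)
    have "(Abar A p N i k *v v) \<bullet> (S *v (Abar A p N i k *v v)) = p i * (1 - p i) * q (C2 i i) v"
      if "i \<in> {1..N}" for i v
      using pp[OF that] that
      by (simp add: Abar_def q_def C2_def inner_congruence matrix_vector_mult_scaleR mult.assoc[symmetric] del: abs_mult flip: scaleR_matrix_vector_assoc)
    then show "q (transpose B ** S ** B) (x \<omega>) + (\<Sum>i=1..N. p i * (1 - p i) * q (C2 i i) (x \<omega>)) =
        x \<omega> \<bullet> (congruence_sum N (\<lambda>i. Abar A p N i k) S *v x \<omega>)"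
      by (simp add: inner_congruence_sum sum.atLeast_Suc_atMost q_def inner_congruence B_def)
  qed
  finally show ?thesis .
qed

text \<open>Signals with values 0 and 1 enlarge the norm in one step by at most the sum of the
  operator norms at that time. The bound may grow with \<open>k\<close>; it serves to make quadratic
  forms of the state integrable.\<close>

lemma (in prob_space) state_AE_bounded:
  fixes A :: "nat \<Rightarrow> nat \<Rightarrow> real^'n^'n"
  assumes ae: "\<And>i k. i \<in> {1..N} \<Longrightarrow> AE \<omega> in M. \<nu> i k \<omega> = 0 \<or> \<nu> i k \<omega> = (1::real)"
  shows "\<exists>c. AE \<omega> in M. norm (state A \<nu> N k0 x0 k \<omega>) \<le> c"
proof (induction k)
  case 0
  then show ?case by auto
next
  case (Suc k)
  then obtain c where c: "AE \<omega> in M. norm (state A \<nu> N k0 x0 k \<omega>) \<le> c"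
    by auto
  have A: "norm (A i k *v v) \<le> onorm ((*v) (A i k)) * norm v" for i v
    by (rule onorm[OF matrix_vector_mul_bounded_linear])
  have o0: "0 \<le> onorm ((*v) (A i k))" for i
    by (rule onorm_pos_le[OF matrix_vector_mul_bounded_linear])
  have aeall: "AE \<omega> in M. \<forall>i\<in>{1..N}. \<nu> i k \<omega> = 0 \<or> \<nu> i k \<omega> = 1"
    using ae by (intro AE_finite_allI) auto
  \<comment> \<open>The maximum with \<open>norm x0\<close> covers the times before
    \<open>k0\<close>, where \<open>state\<close> has the default value \<open>x0\<close>.\<close>
  have "AE \<omega> in M. norm (state A \<nu> N k0 x0 (Suc k) \<omega>) \<le>
      max (norm x0) (onorm ((*v) (A 0 k)) * c + (\<Sum>i=1..N. onorm ((*v) (A i k)) * c))"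
    using c aeall
  proof eventually_elim
    case (elim \<omega>)
    let ?x = "state A \<nu> N k0 x0 k \<omega>"
    have bnd: "norm (A i k *v ?x) \<le> onorm ((*v) (A i k)) * c" for i
      using A[of i ?x] mult_left_mono[OF elim(1) o0[of i]] by linarith
    have "norm (\<nu> i k \<omega> *\<^sub>R (A i k *v ?x)) \<le> onorm ((*v) (A i k)) * c" if "i \<in> {1..N}" for i
    proof -
      have "norm (\<nu> i k \<omega> *\<^sub>R (A i k *v ?x)) \<le> norm (A i k *v ?x)"
        using bspec[OF elim(2) that] by auto
      with bnd show ?thesis by (rule order_trans[rotated])
    qed
    then have "norm (A 0 k *v ?x + (\<Sum>i=1..N. \<nu> i k \<omega> *\<^sub>R (A i k *v ?x))) \<le>
        onorm ((*v) (A 0 k)) * c + (\<Sum>i=1..N. onorm ((*v) (A i k)) * c)"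
      by (intro norm_triangle_mono bnd sum_norm_le) auto
    then show ?case
      by auto
  qed
  then show ?case by blast
qed

section \<open>Symmetric matrices and the Loewner order\<close>

lemma symmetric_form_polarization:
  fixes S :: "real^'n^'n"
  assumes S: "transpose S = S"
  shows "4 * (u \<bullet> (S *v v)) = (u + v) \<bullet> (S *v (u + v)) - (u - v) \<bullet> (S *v (u - v))"
proof -
  have "v \<bullet> (S *v u) = u \<bullet> (S *v v)"
    by (metis S dot_lmul_matrix inner_commute transpose_matrix_vector)
  then show ?thesis
    by (simp add: algebra_simps inner_add_left inner_add_right inner_diff_left inner_diff_right)
qed

text \<open>By polarization on coordinate vectors, a bound on the quadratic form bounds every entry.\<close>

lemma norm_symmetric_matrix_le:
  fixes S :: "real^'n^'n"
  assumes S: "transpose S = S" and q: "\<And>v. \<bar>v \<bullet> (S *v v)\<bar> \<le> c * (norm v)\<^sup>2"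
  shows "norm S \<le> real CARD('n) * real CARD('n) * c"
proof -
  have entry: "\<bar>S $ i $ j\<bar> \<le> c" for i j
  proof -
    let ?u = "axis i 1 :: real^'n" and ?v = "axis j 1 :: real^'n"
    have "?u \<bullet> (S *v ?v) = S $ i $ j"
      by (simp add: inner_axis' matrix_vector_mult_basis column_def)
    then have "4 * \<bar>S $ i $ j\<bar> \<le> c * (norm (?u + ?v))\<^sup>2 + c * (norm (?u - ?v))\<^sup>2"
      using symmetric_form_polarization[OF S, of ?u ?v] q[of "?u + ?v"] q[of "?u - ?v"] by linarith
    also have "\<dots> = c * ((norm (?u + ?v))\<^sup>2 + (norm (?u - ?v))\<^sup>2)"
      by (simp add: distrib_left)
    \<comment> \<open>Parallelogram law for two unit vectors; it covers \<open>i = j\<close> as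
      well.\<close>
    also have "(norm (?u + ?v))\<^sup>2 + (norm (?u - ?v))\<^sup>2 = 4"
      unfolding power2_norm_eq_inner
      by (simp add: inner_add_left inner_add_right inner_diff_left inner_diff_right inner_axis_axis)
    finally show ?thesis by simp
  qed
  have "norm S \<le> (\<Sum>i\<in>UNIV. norm (S $ i))"
    by (simp add: norm_vec_def L2_set_le_sum)
  also have "\<dots> \<le> (\<Sum>i\<in>UNIV. \<Sum>j\<in>UNIV. \<bar>S $ i $ j\<bar>)"
    by (intro sum_mono norm_le_l1_cart)
  also have "\<dots> \<le> (\<Sum>i\<in>(UNIV::'n set). \<Sum>j\<in>(UNIV::'n set). c)"
    by (intro sum_mono entry)
  finally show ?thesis by simp
qed

lemma loewner_leD:
  "X \<preceq>\<^sub>L Y \<Longrightarrow> v \<bullet> (X *v v) \<le> v \<bullet> (Y *v v)"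
  by (simp add: loewner_le_def sym_possemidef_def matrix_vector_mult_diff_rdistrib inner_diff_right)

lemma scaled_identity_form:
  fixes v :: "real^'n"
  shows "v \<bullet> ((a *\<^sub>R mat 1) *v v) = a * (norm v)\<^sup>2"
  by (simp add: power2_norm_eq_inner flip: scaleR_matrix_vector_assoc)

lemma transpose_diff: "transpose (X - Y) = transpose X - transpose (Y :: real^'n^'m)"
  by (simp add: transpose_def vec_eq_iff)

text \<open>The Loewner order also demands that the difference be symmetric, which is where the
  symmetry of \<open>S\<close> enters.\<close>

lemma scaled_identity_loewner_le_iff:
  fixes S :: "real^'n^'n"
  assumes "transpose S = S"
  shows "a *\<^sub>R mat 1 \<preceq>\<^sub>L S \<longleftrightarrow> (\<forall>v. a * (norm v)\<^sup>2 \<le> v \<bullet> (S *v v))"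
    and "S \<preceq>\<^sub>L a *\<^sub>R mat 1 \<longleftrightarrow> (\<forall>v. v \<bullet> (S *v v) \<le> a * (norm v)\<^sup>2)"
  using assms
  by (auto simp: loewner_le_def sym_possemidef_def matrix_vector_mult_diff_rdistrib
      inner_diff_right scaled_identity_form transpose_diff transpose_scalar)

section \<open>Backward Lyapunov iteration and the equivalence\<close>

text \<open>The value is a function of the time because each recursive call moves the time forward
  by one.\<close>

primrec backward_iterate ::
    "(nat \<Rightarrow> real^'n^'n \<Rightarrow> real^'n^'n) \<Rightarrow> nat \<Rightarrow> nat \<Rightarrow> real^'n^'n" where
  "backward_iterate L 0 = (\<lambda>k. mat 1)"
| "backward_iterate L (Suc j) = (\<lambda>k. L k (backward_iterate L j (Suc k)))"

lemma transpose_backward_iterate: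
  assumes "\<And>k S. transpose S = S \<Longrightarrow> transpose (L k S) = L k S"
  shows "transpose (backward_iterate L j k) = backward_iterate L j k"
  using assms by (induction j arbitrary: k) auto

theorem theorem4p9:
  fixes A :: "nat \<Rightarrow> nat \<Rightarrow> real^'n^'n"
    and \<nu> :: "nat \<Rightarrow> nat \<Rightarrow> 'a \<Rightarrow> real"
    and p :: "nat \<Rightarrow> real"
    and N :: nat
    and M :: "'a measure"
  assumes prob: "prob_space M"
    and bdd: "\<forall>i\<in>{0..N}. bounded (range (A i))"
    and stat: "\<forall>i\<in>{1..N}. stationary_process M (\<nu> i)"
    and indep: "\<forall>k0 x0. \<forall>k\<ge>k0.
      indep_signals_state M N (\<lambda>i. \<nu> i k) (state A \<nu> N k0 x0 k)"
    and bern1: "\<forall>i\<in>{1..N}. \<forall>k. prob_space.prob M {\<omega> \<in> space M. \<nu> i k \<omega> = 1} = p i"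
    and bern0: "\<forall>i\<in>{1..N}. \<forall>k. prob_space.prob M {\<omega> \<in> space M. \<nu> i k \<omega> = 0} = 1 - p i"
  shows "unif_exp_ms_stable M A \<nu> N \<longleftrightarrow>
    (\<exists>(P :: nat \<Rightarrow> real^'n^'n) (Q :: nat \<Rightarrow> real^'n^'n) \<alpha>\<^sub>1 \<alpha>\<^sub>2 \<beta>\<^sub>1 \<beta>\<^sub>2.
       range P \<subseteq> sym_posdef \<and> range Q \<subseteq> sym_posdef \<and>
       0 < \<alpha>\<^sub>1 \<and> 0 < \<alpha>\<^sub>2 \<and> 0 < \<beta>\<^sub>1 \<and> 0 < \<beta>\<^sub>2 \<and>
       (\<forall>k. \<alpha>\<^sub>1 *\<^sub>R mat 1 \<preceq>\<^sub>L P k \<and> P k \<preceq>\<^sub>L \<alpha>\<^sub>2 *\<^sub>R mat 1 \<and>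
            \<beta>\<^sub>1 *\<^sub>R mat 1 \<preceq>\<^sub>L Q k \<and> Q k \<preceq>\<^sub>L \<beta>\<^sub>2 *\<^sub>R mat 1 \<and>
            (\<Sum>i=0..N. transpose (Abar A p N i k) ** P (k + 1) ** Abar A p N i k)
              - P k + Q k = 0))"
proof -
  interpret prob_space M by (rule prob)
  define L where "L k = congruence_sum N (\<lambda>i. Abar A p N i k)" for k
  define E where "E k0 x0 S k = expectation (\<lambda>\<omega>. state A \<nu> N k0 x0 k \<omega> \<bullet> (S *v state A \<nu> N k0 x0 k \<omega>))"
    for k0 k x0 and S :: "real^'n^'n"
  have ind: "indep_signals_state M N (\<lambda>i. \<nu> i k) (state A \<nu> N k0 x0 k)" if "k0 \<le> k" for k0 k x0
    using indep that by blast
  \<comment> \<open>Measurability of the signal at time \<open>k\<close> is read off the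
    independence assumption with initial time \<open>k\<close>.\<close>
  have "AE \<omega> in M. \<nu> i k \<omega> = 0 \<or> \<nu> i k \<omega> = 1" if "i \<in> {1..N}" for i k
    using ind[of k k] that bern1 bern0
    by (intro bernoulli_AE[of _ "p i"]) (auto simp: indep_signals_state_def)
  then have bd: "\<exists>c. AE \<omega> in M. norm (state A \<nu> N k0 x0 k \<omega>) \<le> c" for k0 x0 k
    by (rule state_AE_bounded)
  have qint: "integrable M (\<lambda>\<omega>. state A \<nu> N k0 x0 k \<omega> \<bullet> (S *v state A \<nu> N k0 x0 k \<omega>))"
    if "k0 \<le> k" for k0 x0 k and S :: "real^'n^'n"
    using bd[of k0 x0 k] ind[OF that, of x0]
    by (auto intro: integrable_quadratic_form simp: indep_signals_state_def)
  have sq: "expectation (\<lambda>\<omega>. (norm (state A \<nu> N k0 x0 k \<omega>))\<^sup>2) = E k0 x0 (mat 1) k" for k0 x0 k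
    by (simp add: E_def power2_norm_eq_inner)
  have E0: "E k x0 S k = x0 \<bullet> (S *v x0)" for k x0 S
    by (simp add: E_def state_initial prob_space)
  have step: "E k0 x0 S (Suc k) = E k0 x0 (L k S) k" if k: "k0 \<le> k" for k0 x0 k S
  proof -
    obtain c where "AE \<omega> in M. norm (state A \<nu> N k0 x0 k \<omega>) \<le> c"
      using bd by blast
    from expectation_quadratic_form_step[OF ind[OF k] _ _ this, of p A k S]
    show ?thesis
      using bern1 bern0 k by (simp add: E_def L_def)
  qed
  have mono: "E k0 x0 S k \<le> E k0 x0 S' k"
    if "k0 \<le> k" "\<And>v. v \<bullet> (S *v v) \<le> v \<bullet> (S' *v v)" for k0 x0 k S S'
    unfolding E_def using that by (intro integral_mono qint) auto
  have scaled: "E k0 x0 (a *\<^sub>R S) k = a * E k0 x0 S k" for k0 x0 k a S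
    by (simp add: E_def flip: scaleR_matrix_vector_assoc)
  have stable_iff: "unif_exp_ms_stable M A \<nu> N \<longleftrightarrow>
    (\<exists>\<rho> \<beta>. 0 \<le> \<rho> \<and> \<rho> < 1 \<and> 1 < \<beta> \<and>
      (\<forall>k0 k x0. k0 \<le> k \<longrightarrow> E k0 x0 (mat 1) k \<le> \<beta> * \<rho> ^ (k - k0) * (norm x0)\<^sup>2))"
    by (simp add: unif_exp_ms_stable_def sq prob_space)
  show ?thesis
  proof
    assume "unif_exp_ms_stable M A \<nu> N"
    then obtain \<rho> \<beta> where \<rho>: "0 \<le> \<rho>" "\<rho> < 1" and \<beta>: "1 < \<beta>"
      and decay: "\<And>k0 k x0. k0 \<le> k \<Longrightarrow> E k0 x0 (mat 1) k \<le> \<beta> * \<rho> ^ (k - k0) * (norm x0)\<^sup>2"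
      unfolding stable_iff by blast
    define T where "T = backward_iterate L"
    have symT: "transpose (T j k) = T j k" for j k
      unfolding T_def
      by (rule transpose_backward_iterate) (simp add: L_def transpose_congruence_sum)
    \<comment> \<open>Each use of \<open>step\<close> removes the outermost operator
      \<open>L m\<close> and moves the evaluation time from \<open>m\<close> to
      \<open>Suc m\<close>; hence \<open>m\<close> is arbitrary in the induction.\<close>
    have ET: "E k0 x0 (T j m) m = E k0 x0 (mat 1) (m + j)" if "k0 \<le> m" for k0 x0 j m
      using that
    proof (induction j arbitrary: m)
      case (Suc j)
      then show ?case
        using step[of k0 m x0 "T j (Suc m)"] by (simp add: T_def)
    qed (simp add: T_def)
    \<comment> \<open>With \<open>k0 = k\<close> the state at time \<open>k\<close> is the
      deterministic vector \<open>v\<close>.\<close>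
    have qT: "v \<bullet> (T j k *v v) = E k v (mat 1) (k + j)" for v j k
      using ET[of k k v j] by (simp add: E0)
    have qT_nonneg: "0 \<le> v \<bullet> (T j k *v v)" for v j k
      unfolding qT by (simp add: E_def)
    have qT_le: "v \<bullet> (T j k *v v) \<le> \<beta> * \<rho> ^ j * (norm v)\<^sup>2" for v j k
      using decay[of k "k + j" v] by (simp add: qT)
    let ?n = "real CARD('n) * real CARD('n)"
    \<comment> \<open>Decay of the nonnegative forms becomes decay in norm, so the matrix series is
      dominated by a geometric one.\<close>
    have normT: "norm (T j k) \<le> ?n * \<beta> * \<rho> ^ j" for j k
      using norm_symmetric_matrix_le[OF symT, of j k "\<beta> * \<rho> ^ j"] qT_nonneg qT_le
      by (simp add: mult.assoc)
    have sumT: "summable (\<lambda>j. T j k)" for k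
      by (rule summable_comparison_test'[OF _ normT])
        (use \<rho> in \<open>intro summable_mult summable_geometric, simp\<close>)
    define P where "P k = (\<Sum>j. T j k)" for k
    have P_form: "(\<lambda>j. u \<bullet> (T j k *v v)) sums (u \<bullet> (P k *v v))" for k u v
    proof -
      have "linear (\<lambda>S::real^'n^'n. u \<bullet> (S *v v))"
        by (rule linearI)
          (simp_all add: matrix_vector_mult_add_rdistrib inner_add_right flip: scaleR_matrix_vector_assoc)
      then have "bounded_linear (\<lambda>S::real^'n^'n. u \<bullet> (S *v v))"
        by (simp add: linear_conv_bounded_linear)
      from bounded_linear.sums[OF this summable_sums[OF sumT]] show ?thesis
        by (simp only: P_def)
    qed
    have symP: "transpose (P k) = P k" for k
    proof -
      have "linear (transpose :: real^'n^'n \<Rightarrow> real^'n^'n)"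
        by (rule linearI) (simp_all add: transpose_def vec_eq_iff)
      then have "bounded_linear (transpose :: real^'n^'n \<Rightarrow> real^'n^'n)"
        by (simp add: linear_conv_bounded_linear)
      from bounded_linear.suminf[OF this sumT] show ?thesis
        by (simp add: symT P_def)
    qed
    \<comment> \<open>The term of index 0 is the identity and all others have nonnegative forms. The
      factor \<open>1\<close> is the later witness for \<open>\<alpha>\<^sub>1\<close>.\<close>
    have P_ge: "1 * (norm v)\<^sup>2 \<le> v \<bullet> (P k *v v)" for k v
      using sum_le_suminf[OF sums_summable[OF P_form], of "{0}" v k v] qT_nonneg
        sums_unique[OF P_form[of v k v]]
      by (simp add: T_def power2_norm_eq_inner)
    \<comment> \<open>Summing the geometric decay of the terms gives the witness for
      \<open>\<alpha>\<^sub>2\<close>.\<close>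
    have P_le: "v \<bullet> (P k *v v) \<le> \<beta> / (1 - \<rho>) * (norm v)\<^sup>2" for k v
    proof (rule sums_le[OF qT_le P_form])
      show "(\<lambda>j. \<beta> * \<rho> ^ j * (norm v)\<^sup>2) sums (\<beta> / (1 - \<rho>) * (norm v)\<^sup>2)"
        using sums_mult2[OF sums_mult[OF geometric_sums[of \<rho>]], of \<beta> "(norm v)\<^sup>2"] \<rho> by simp
    qed
    \<comment> \<open>Applying \<open>L k\<close> to the series at time \<open>k + 1\<close> yields
      the series at time \<open>k\<close> without its head, the identity.\<close>
    have lyap: "L k (P (k + 1)) - P k + mat 1 = 0" for k
    proof -
      have "L k (P (k + 1)) = (\<Sum>j. L k (T j (Suc k)))"
        unfolding P_def L_def using sumT
        by (simp add: bounded_linear.suminf[OF bounded_linear_congruence_sum])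
      also have "\<dots> = (\<Sum>j. T (Suc j) k)"
        by (simp add: T_def)
      also have "\<dots> = P k - mat 1"
        using suminf_split_head[OF sumT, of k] by (simp add: P_def T_def)
      finally show ?thesis by simp
    qed
    have pd: "P k \<in> sym_posdef" for k
      unfolding sym_posdef_def using symP P_ge
      by (auto intro!: less_le_trans[OF _ P_ge])
    have P_loewner: "1 *\<^sub>R mat 1 \<preceq>\<^sub>L P k" "P k \<preceq>\<^sub>L (\<beta> / (1 - \<rho>)) *\<^sub>R mat 1" for k
      unfolding scaled_identity_loewner_le_iff[OF symP] using P_ge P_le by blast+
    have id_loewner: "1 *\<^sub>R mat 1 \<preceq>\<^sub>L (mat 1 :: real^'n^'n)" "(mat 1 :: real^'n^'n) \<preceq>\<^sub>L 1 *\<^sub>R mat 1"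
      by (simp_all add: loewner_le_def sym_possemidef_def transpose_def vec_eq_iff)
    have idpd: "(mat 1 :: real^'n^'n) \<in> sym_posdef"
      by (simp add: sym_posdef_def)
    show "\<exists>(P :: nat \<Rightarrow> real^'n^'n) (Q :: nat \<Rightarrow> real^'n^'n) \<alpha>\<^sub>1 \<alpha>\<^sub>2 \<beta>\<^sub>1 \<beta>\<^sub>2.
       range P \<subseteq> sym_posdef \<and> range Q \<subseteq> sym_posdef \<and>
       0 < \<alpha>\<^sub>1 \<and> 0 < \<alpha>\<^sub>2 \<and> 0 < \<beta>\<^sub>1 \<and> 0 < \<beta>\<^sub>2 \<and>
       (\<forall>k. \<alpha>\<^sub>1 *\<^sub>R mat 1 \<preceq>\<^sub>L P k \<and> P k \<preceq>\<^sub>L \<alpha>\<^sub>2 *\<^sub>R mat 1 \<and>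
            \<beta>\<^sub>1 *\<^sub>R mat 1 \<preceq>\<^sub>L Q k \<and> Q k \<preceq>\<^sub>L \<beta>\<^sub>2 *\<^sub>R mat 1 \<and>
            (\<Sum>i=0..N. transpose (Abar A p N i k) ** P (k + 1) ** Abar A p N i k)
              - P k + Q k = 0)"
      using pd idpd \<rho> \<beta> P_loewner id_loewner lyap
      by (rule_tac exI[of _ P], rule_tac exI[of _ "\<lambda>_. mat 1"], rule_tac exI[of _ 1],
          rule_tac exI[of _ "\<beta> / (1 - \<rho>)"], rule_tac exI[of _ 1], rule_tac exI[of _ 1])
        (auto simp: L_def congruence_sum_def)
  next
    assume "\<exists>(P :: nat \<Rightarrow> real^'n^'n) (Q :: nat \<Rightarrow> real^'n^'n) \<alpha>\<^sub>1 \<alpha>\<^sub>2 \<beta>\<^sub>1 \<beta>\<^sub>2.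
       range P \<subseteq> sym_posdef \<and> range Q \<subseteq> sym_posdef \<and>
       0 < \<alpha>\<^sub>1 \<and> 0 < \<alpha>\<^sub>2 \<and> 0 < \<beta>\<^sub>1 \<and> 0 < \<beta>\<^sub>2 \<and>
       (\<forall>k. \<alpha>\<^sub>1 *\<^sub>R mat 1 \<preceq>\<^sub>L P k \<and> P k \<preceq>\<^sub>L \<alpha>\<^sub>2 *\<^sub>R mat 1 \<and>
            \<beta>\<^sub>1 *\<^sub>R mat 1 \<preceq>\<^sub>L Q k \<and> Q k \<preceq>\<^sub>L \<beta>\<^sub>2 *\<^sub>R mat 1 \<and>
            (\<Sum>i=0..N. transpose (Abar A p N i k) ** P (k + 1) ** Abar A p N i k)
              - P k + Q k = 0)"
    then obtain P Q :: "nat \<Rightarrow> real^'n^'n" and a1 a2 b1 b2 where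
      pos: "0 < a1" "0 < a2" "0 < b1" and
      all: "\<forall>k. a1 *\<^sub>R mat 1 \<preceq>\<^sub>L P k \<and> P k \<preceq>\<^sub>L a2 *\<^sub>R mat 1 \<and>
        b1 *\<^sub>R mat 1 \<preceq>\<^sub>L Q k \<and> Q k \<preceq>\<^sub>L b2 *\<^sub>R mat 1 \<and>
        (\<Sum>i=0..N. transpose (Abar A p N i k) ** P (k + 1) ** Abar A p N i k) - P k + Q k = 0"
      by blast
    have P: "a1 *\<^sub>R mat 1 \<preceq>\<^sub>L P k" "P k \<preceq>\<^sub>L a2 *\<^sub>R mat 1"
      and Q: "b1 *\<^sub>R mat 1 \<preceq>\<^sub>L Q k"
      and eq: "L k (P (Suc k)) - P k + Q k = 0" for k
      using spec[OF all, of k] by (simp_all add: L_def congruence_sum_def)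
    \<comment> \<open>Since Q(k) dominates b1 I and I dominates P(k)/a2, subtracting Q(k) removes at
      least the fraction b1/a2 of P(k). The maximum with 0 keeps the rate nonnegative, as stability
      demands.\<close>
    define \<rho> where "\<rho> = max 0 (1 - b1 / a2)"
    have \<rho>: "0 \<le> \<rho>" "\<rho> < 1"
      using pos by (auto simp: \<rho>_def)
    have contract: "v \<bullet> (L k (P (Suc k)) *v v) \<le> v \<bullet> ((\<rho> *\<^sub>R P k) *v v)" for k v
    proof -
      have "L k (P (Suc k)) = P k - Q k"
        using eq[of k] by (simp add: algebra_simps)
      then have "v \<bullet> (L k (P (Suc k)) *v v) = v \<bullet> (P k *v v) - v \<bullet> (Q k *v v)"
        by (simp add: matrix_vector_mult_diff_rdistrib inner_diff_right)
      also have "\<dots> \<le> v \<bullet> (P k *v v) - b1 / a2 * (a2 * (norm v)\<^sup>2)"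
        using loewner_leD[OF Q, of v k] pos by (simp add: scaled_identity_form)
      also have "\<dots> \<le> v \<bullet> (P k *v v) - b1 / a2 * (v \<bullet> (P k *v v))"
        using loewner_leD[OF P(2), of v k] pos
        by (intro diff_left_mono mult_left_mono) (auto simp: scaled_identity_form)
      also have "\<dots> = (1 - b1 / a2) * (v \<bullet> (P k *v v))"
        by (simp add: algebra_simps)
      also have "\<dots> \<le> \<rho> * (v \<bullet> (P k *v v))"
      proof (rule mult_right_mono)
        have "0 \<le> a1 * (norm v)\<^sup>2"
          using pos by simp
        also have "\<dots> \<le> v \<bullet> (P k *v v)"
          using loewner_leD[OF P(1), of v k] by (simp add: scaled_identity_form)
        finally show "0 \<le> v \<bullet> (P k *v v)" .
      qed (simp add: \<rho>_def)
      finally show ?thesis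
        by (simp flip: scaleR_matrix_vector_assoc)
    qed
    have decayP: "E k0 x0 (P (k0 + j)) (k0 + j) \<le> \<rho> ^ j * (x0 \<bullet> (P k0 *v x0))" for k0 x0 j
    proof (induction j)
      case (Suc j)
      have "E k0 x0 (P (k0 + Suc j)) (k0 + Suc j) \<le> E k0 x0 (\<rho> *\<^sub>R P (k0 + j)) (k0 + j)"
        using mono[OF _ contract, of k0 "k0 + j" x0] by (simp add: step)
      also have "\<dots> \<le> \<rho> * (\<rho> ^ j * (x0 \<bullet> (P k0 *v x0)))"
        using Suc \<rho> by (simp add: scaled mult_left_mono)
      finally show ?case by (simp add: mult.assoc)
    qed (simp add: E0)
    \<comment> \<open>The bounds on P give the constant a2/a1; adding 1 ensures that it strictly
      exceeds 1, as the definition of stability asks.\<close>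
    have "E k0 x0 (mat 1) k \<le> (1 + a2 / a1) * \<rho> ^ (k - k0) * (norm x0)\<^sup>2" if k: "k0 \<le> k" for k0 k x0
    proof -
      have "a1 * E k0 x0 (mat 1) k \<le> E k0 x0 (P k) k"
        unfolding scaled[symmetric] using k loewner_leD[OF P(1)] by (rule mono)
      also have "\<dots> \<le> \<rho> ^ (k - k0) * (x0 \<bullet> (P k0 *v x0))"
        using decayP[of k0 x0 "k - k0"] k by simp
      also have "\<dots> \<le> \<rho> ^ (k - k0) * (a2 * (norm x0)\<^sup>2)"
        using loewner_leD[OF P(2), of x0 k0] \<rho>
        by (intro mult_left_mono) (auto simp: scaled_identity_form)
      also have "\<dots> \<le> \<rho> ^ (k - k0) * ((a1 + a2) * (norm x0)\<^sup>2)"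
        using \<rho> pos by (intro mult_left_mono mult_right_mono) auto
      finally show ?thesis
        using pos by (simp add: field_simps)
    qed
    then show "unif_exp_ms_stable M A \<nu> N"
      unfolding stable_iff using \<rho> pos
      by (intro exI[of _ \<rho>] exI[of _ "1 + a2 / a1"]) auto
  qed
qed

end
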